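(* Let $\mathcal{K}=\{1,\dots,K\}$, $\mathcal{N}=\{1,\dots,N\}$, $\mathcal{T}=\{1,\dots,T\}$, and let prices $p_k(t)>0$ ($k\in\mathcal{K}$, $t\in\mathcal{T}$) be given. For each consumer $n\in\mathcal{N}$, with budget $B_n\ge 0$, minimum energy need $E_n^{\min}\ge 0$ and parameter $\zeta_n\ge 1$, the demands $$d^*_{n,k}(t)=\frac{B_n+\sum_{j\in\mathcal{K}}\sum_{h\in\mathcal{T}}p_j(h)\zeta_n}{KT\,p_k(t)}-\zeta_n,\qquad k\in\mathcal{K},\ t\in\mathcal{T},$$ satisfy the minimum energy constraint $$\sum_{k\in\mathcal{K}}\sum_{t\in\mathcal{T}}d^*_{n,k}(t)\ge E_n^{\min}$$ if, and only if, $$B_n\ \ge\ \frac{E_n^{\min}+\zeta_n KT}{\sum_{k\in\mathcal{K}}\sum_{t\in\mathcal{T}}\frac{1}{KT\,p_k(t)}}-\zeta_n\sum_{k\in\mathcal{K}}\sum_{t\in\mathcal{T}}p_k(t).$$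
   Context: $\mathcal{K}$ is the set of utility companies, $\mathcal{N}$ the set of consumers, $\mathcal{T}$ the set of time slots. $p_k(t)$ is the price of company $k$ at time $t$ and $d_{n,k}(t)$ is the demand of consumer $n$ from company $k$ at time $t$. *)

theory Defs
  imports Complex_Main
begin

definition opt_demand ::
  "nat \<Rightarrow> nat \<Rightarrow> (nat \<Rightarrow> nat \<Rightarrow> real) \<Rightarrow> (nat \<Rightarrow> real) \<Rightarrow> (nat \<Rightarrow> real)
    \<Rightarrow> nat \<Rightarrow> nat \<Rightarrow> nat \<Rightarrow> real" where
  "opt_demand K T p B \<zeta> n k t =
     (B n + (\<Sum>j\<in>{1..K}. \<Sum>h\<in>{1..T}. p j h * \<zeta> n)) / (real K * real T * p k t) - \<zeta> n"

end

theory Submission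
  imports Defs
begin

text \<open>
  The numerator of the demand formula depends neither on the company nor on the time slot, so
  the total demand is an affine function of the budget whose slope is the sum of the
  reciprocals \<open>1 / (K T p\<^sub>k(t))\<close>. Prices being positive, this slope is positive, and the
  inequality ``total demand at least \<open>E\<close>'' can be solved for the budget by one division that
  preserves its direction.
\<close>

lemma sum_opt_demand_affine:
  "(\<Sum>k\<in>{1..K}. \<Sum>t\<in>{1..T}. opt_demand K T p B \<zeta> n k t) =
     (B n + \<zeta> n * (\<Sum>k\<in>{1..K}. \<Sum>t\<in>{1..T}. p k t)) *
       (\<Sum>k\<in>{1..K}. \<Sum>t\<in>{1..T}. 1 / (real K * real T * p k t))
     - \<zeta> n * real K * real T"
proof -
  have "(\<Sum>j\<in>{1..K}. \<Sum>h\<in>{1..T}. p j h * \<zeta> n) = \<zeta> n * (\<Sum>k\<in>{1..K}. \<Sum>t\<in>{1..T}. p k t)"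
    by (simp add: sum_distrib_left mult.commute)
  then have "opt_demand K T p B \<zeta> n k t =
      (B n + \<zeta> n * (\<Sum>k\<in>{1..K}. \<Sum>t\<in>{1..T}. p k t)) * (1 / (real K * real T * p k t)) - \<zeta> n"
    for k t
    by (simp add: opt_demand_def)
  then show ?thesis
    by (simp only: sum_subtractf sum_distrib_left [symmetric]) simp
qed

theorem theorem1:
  fixes K N T :: nat
    and p :: "nat \<Rightarrow> nat \<Rightarrow> real"
    and B Emin \<zeta> :: "nat \<Rightarrow> real"
  assumes "K \<ge> 1" and "T \<ge> 1"
    and "\<And>k t. k \<in> {1..K} \<Longrightarrow> t \<in> {1..T} \<Longrightarrow> p k t > 0"
    and "\<And>n. n \<in> {1..N} \<Longrightarrow> B n \<ge> 0"
    and "\<And>n. n \<in> {1..N} \<Longrightarrow> Emin n \<ge> 0"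
    and "\<And>n. n \<in> {1..N} \<Longrightarrow> \<zeta> n \<ge> 1"
  shows "\<forall>n\<in>{1..N}.
    (\<Sum>k\<in>{1..K}. \<Sum>t\<in>{1..T}. opt_demand K T p B \<zeta> n k t) \<ge> Emin n \<longleftrightarrow>
    B n \<ge> (Emin n + \<zeta> n * real K * real T) /
              (\<Sum>k\<in>{1..K}. \<Sum>t\<in>{1..T}. 1 / (real K * real T * p k t))
            - \<zeta> n * (\<Sum>k\<in>{1..K}. \<Sum>t\<in>{1..T}. p k t)"
proof
  fix n assume "n \<in> {1..N}"
  define S where "S = (\<Sum>k\<in>{1..K}. \<Sum>t\<in>{1..T}. 1 / (real K * real T * p k t))"
  have "S > 0"
    unfolding S_def using assms(1-3) by (intro sum_pos) auto
  then show "(\<Sum>k\<in>{1..K}. \<Sum>t\<in>{1..T}. opt_demand K T p B \<zeta> n k t) \<ge> Emin n \<longleftrightarrow>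
    B n \<ge> (Emin n + \<zeta> n * real K * real T) /
              (\<Sum>k\<in>{1..K}. \<Sum>t\<in>{1..T}. 1 / (real K * real T * p k t))
            - \<zeta> n * (\<Sum>k\<in>{1..K}. \<Sum>t\<in>{1..T}. p k t)"
    unfolding sum_opt_demand_affine S_def [symmetric]
    by (simp add: diff_le_eq le_diff_eq pos_divide_le_eq)
qed

end
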